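(* Let $w$ be a Baxter permutation of length $n$ that is fixed under $90^{\circ}$ rotation, and let $p$ be a position such that inserting a new largest entry $n+1$ into $w$ at position $p$ (i.e. between the same consecutive entries of $w$, or at an end) yields a Baxter permutation. Then it is possible to additionally insert a new smallest entry, a new first entry and a new last entry so that the result is a Baxter permutation $w'$ of length $n+4$ that is fixed under $90^{\circ}$ rotation; that is, there is a Baxter permutation $w'$ of length $n+4$ fixed under $90^{\circ}$ rotation such that deleting from $w'$ its largest entry, its smallest entry, its first entry and its last entry (and standardizing the remaining entries to $[n]$) gives $w$, and in which the largest entry $n+4$ lies in the same gap between entries originating from $w$ as the inserted $n+1$ occupies at position $p$.
   Context: A permutation $w=w_1\ldots w_n$ is a Baxter permutation if there are no indices $i<j<j+1<k$ with $w_j<w_k<w_i<w_{j+1}$ (pattern 3-14-2) and no indices $i<j<j+1<k$ with $w_{j+1}<w_i<w_k<w_j$ (pattern 2-41-3). A permutation $w$ of length $n$ is fixed under $90^{\circ}$ rotation (of its permutation matrix) if for all $i$, $w_i=j$ implies $w_j=n+1-i$ (equivalently $w_{w_i}=n+1-i$ for all $i$). Inserting a new smallest entry means increasing all entries by $1$ and inserting $1$ somewhere; inserting a new first (resp. last) entry $j$ means increasing all entries $\ge j$ by $1$ and prepending (resp. appending) $j$.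
   Formalization: The length n is assumed to be at least 1; for the empty permutation the claim fails, since the only permutations of length 4 fixed under 90° rotation are 2413 and 3142, and neither is Baxter. *)

theory Defs
  imports "HOL-Combinatorics.Multiset_Permutations"
begin

text \<open>
  A permutation \<open>w\<^sub>1 \<dots> w\<^sub>n\<close> in one-line notation is a list \<open>w \<in> permutations_of_set {1..n}\<close>;
  the entry \<open>w\<^sub>i\<close> is \<open>w ! (i - 1)\<close>.
\<close>

text \<open>The patterns 3-14-2 and 2-41-3; they only involve the relative order of the
  positions, so the list indices are used directly.\<close>

definition baxter :: "nat list \<Rightarrow> bool" where
  "baxter w \<longleftrightarrow>
     (\<nexists>i j k. i < j \<and> j + 1 < k \<and> k < length w \<and>
        w ! j < w ! k \<and> w ! k < w ! i \<and> w ! i < w ! (j + 1)) \<and>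
     (\<nexists>i j k. i < j \<and> j + 1 < k \<and> k < length w \<and>
        w ! (j + 1) < w ! i \<and> w ! i < w ! k \<and> w ! k < w ! j)"

definition baxter_perm :: "nat \<Rightarrow> nat list \<Rightarrow> bool" where
  "baxter_perm n w \<longleftrightarrow> w \<in> permutations_of_set {1..n} \<and> baxter w"

definition rotation_fixed :: "nat list \<Rightarrow> bool" where
  "rotation_fixed w \<longleftrightarrow>
     (\<forall>i \<in> {1..length w}. \<forall>j \<in> {1..length w}.
        w ! (i - 1) = j \<longrightarrow> w ! (j - 1) = length w + 1 - i)"

text \<open>The gap \<open>p\<close> is the one preceded by exactly \<open>p\<close> entries of \<open>w\<close>.\<close>

definition insert_largest :: "nat \<Rightarrow> nat list \<Rightarrow> nat list" where
  "insert_largest p w = take p w @ [length w + 1] @ drop p w"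

definition standardize :: "nat list \<Rightarrow> nat list" where
  "standardize xs = map (\<lambda>x. card {y \<in> set xs. y \<le> x}) xs"

definition inner_entry :: "nat list \<Rightarrow> nat \<Rightarrow> bool" where
  "inner_entry w x \<longleftrightarrow> x \<notin> {Max (set w), Min (set w), hd w, last w}"

definition delete_outer :: "nat list \<Rightarrow> nat list" where
  "delete_outer w = filter (inner_entry w) w"

definition largest_gap :: "nat list \<Rightarrow> nat" where
  "largest_gap w = length (filter (inner_entry w) (takeWhile (\<lambda>x. x \<noteq> Max (set w)) w))"

end

theory Submission
  imports Defs
begin

text \<open>
  Draw \<open>w\<close> as the points \<open>(2i - n - 1, 2w\<^sub>i - n - 1)\<close>, so that the rotation becomes
  \<open>(x, y) \<mapsto> (y, - x)\<close>. The new largest entry is the point \<open>north = (t, m)\<close> with \<open>t = 2p - n\<close>,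
  \<open>m = n + 1\<close>, and rotation invariance forces the other three new points to be its rotations
  \<open>east = (m, - t)\<close>, \<open>south = (- t, - m)\<close>, \<open>west = (- m, t)\<close>.

  An occurrence of 3-14-2 can be shrunk until its entries 3 and 2 are consecutive in value as well;
  such tight occurrences are permuted by the rotation, and the reflection \<open>(x, y) \<mapsto> (- x, y)\<close>
  exchanges the two forbidden patterns, so only 3-14-2 has to be treated.
  The new points \<open>west, south, north, east\<close> can only play the parts 3, 1, 4, 2 respectively.
  The origin is a point of \<open>w\<close>, because otherwise the four points of \<open>w\<close> closest to the two axes
  form a forbidden pattern; it separates \<open>west\<close> from \<open>east\<close> and \<open>south\<close> from \<open>north\<close>, so
  opposite new points are never in the same tight occurrence. If \<open>north\<close> is in one but \<open>east\<close> is
  not, then the part 3 is \<open>west\<close>, because \<open>w\<close> with \<open>north\<close> is Baxter; and then every old point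
  left of \<open>north\<close> lies below \<open>west\<close>. There are as many old points left of \<open>north\<close> as below
  \<open>west\<close>, so the two sets coincide, although the part 2 belongs only to the second. Hence \<open>north\<close>
  always comes with \<open>east\<close>; rotating, \<open>west\<close> comes with \<open>north\<close>, hence with \<open>east\<close>, which is
  impossible.
\<close>

subsection \<open>Tight occurrences of 3-14-2 in point sets\<close>

definition occ_3142 ::
    "('a::linorder \<times> 'b::linorder) set \<Rightarrow> 'a \<times> 'b \<Rightarrow> 'a \<times> 'b \<Rightarrow> 'a \<times> 'b \<Rightarrow> 'a \<times> 'b \<Rightarrow> bool" where
  "occ_3142 S a b c d \<longleftrightarrow> {a, b, c, d} \<subseteq> S \<and>
     fst a < fst b \<and> fst b < fst c \<and> fst c < fst d \<and>
     snd b < snd d \<and> snd d < snd a \<and> snd a < snd c \<and>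
     (\<forall>e\<in>S. \<not> (fst b < fst e \<and> fst e < fst c))"

definition tight_3142 ::
    "('a::linorder \<times> 'b::linorder) set \<Rightarrow> 'a \<times> 'b \<Rightarrow> 'a \<times> 'b \<Rightarrow> 'a \<times> 'b \<Rightarrow> 'a \<times> 'b \<Rightarrow> bool" where
  "tight_3142 S a b c d \<longleftrightarrow> occ_3142 S a b c d \<and> (\<forall>e\<in>S. \<not> (snd d < snd e \<and> snd e < snd a))"

definition avoids_3142 :: "('a::linorder \<times> 'b::linorder) set \<Rightarrow> bool" where
  "avoids_3142 S \<longleftrightarrow> (\<nexists>a b c d. occ_3142 S a b c d)"

lemma avoids_3142D: "avoids_3142 S \<Longrightarrow> \<not> occ_3142 S a b c d"
  unfolding avoids_3142_def by blast

lemma occ_3142_subset: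
  assumes "occ_3142 S a b c d" "{a, b, c, d} \<subseteq> T" "T \<subseteq> S"
  shows "occ_3142 T a b c d"
  using assms by (auto simp: occ_3142_def)

lemma tight_3142_exists:
  assumes "finite S" "inj_on fst S" "occ_3142 S a b c d"
  shows "\<exists>a d. tight_3142 S a b c d"
proof -
  let ?strip = "\<lambda>a d. {e \<in> S. snd d < snd e \<and> snd e < snd a}"
  show ?thesis using assms(3)
  proof (induction "card (?strip a d)" arbitrary: a d rule: less_induct)
    case less
    show ?case
    proof (cases "tight_3142 S a b c d")
      case False
      then obtain e where e: "e \<in> S" "snd d < snd e" "snd e < snd a"
        using less.prems by (auto simp: tight_3142_def)
      note occ = less.prems[unfolded occ_3142_def]
      have "e \<noteq> b" "e \<noteq> c" using e occ by auto
      then have "fst e \<noteq> fst b" "fst e \<noteq> fst c"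
        using assms(2) e(1) occ by (auto dest: inj_onD)
      then consider (left) "fst e < fst b" | (right) "fst c < fst e"
        using occ e(1) by (meson linorder_neqE)
      then show ?thesis
      proof cases
        case left
        then have "occ_3142 S e b c d" using occ e by (auto simp: occ_3142_def)
        moreover have "?strip e d \<subset> ?strip a d" using e by auto
        ultimately show ?thesis using less.hyps[of d e] assms(1) by (simp add: psubset_card_mono)
      next
        case right
        then have "occ_3142 S a b c e" using occ e by (auto simp: occ_3142_def)
        moreover have "?strip a e \<subset> ?strip a d" using e by auto
        ultimately show ?thesis using less.hyps[of e a] assms(1) by (simp add: psubset_card_mono)
      qed
    qed blast
  qed
qed

subsection \<open>Rotation-invariant point sets\<close>

definition rot :: "'a::group_add \<times> 'a \<Rightarrow> 'a \<times> 'a" where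
  "rot s = (snd s, - fst s)"

definition hflip :: "'a::group_add \<times> 'a \<Rightarrow> 'a \<times> 'a" where
  "hflip s = (- fst s, snd s)"

lemma rot_simps [simp]: "fst (rot s) = snd s" "snd (rot s) = - fst s"
  by (simp_all add: rot_def)

lemma hflip_simps [simp]: "fst (hflip s) = - fst s" "snd (hflip s) = snd s"
  by (simp_all add: hflip_def)

lemma rot_rot_rot_rot [simp]: "rot (rot (rot (rot s))) = s"
  by (simp add: rot_def)

lemma rot_hflip: "rot (hflip s) = hflip (rot (rot (rot s)))"
  by (simp add: rot_def hflip_def)

lemma inj_on_rot: "inj_on rot A"
  by (rule inj_on_inverseI[where g = "rot \<circ> rot \<circ> rot"]) simp

lemma tight_3142_rot:
  fixes S :: "('a::linordered_ab_group_add \<times> 'a) set"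
  shows "tight_3142 S a b c d \<Longrightarrow> tight_3142 (rot ` S) (rot b) (rot d) (rot a) (rot c)"
  by (auto simp: tight_3142_def occ_3142_def)

lemma occ_3142_half_turn:
  fixes S :: "('a::linordered_ab_group_add \<times> 'a) set"
  shows "occ_3142 S a b c d \<Longrightarrow>
    occ_3142 (rot ` rot ` S) (rot (rot d)) (rot (rot c)) (rot (rot b)) (rot (rot a))"
  by (auto simp: occ_3142_def)

lemma avoids_3142_half_turn:
  fixes S :: "('a::linordered_ab_group_add \<times> 'a) set"
  shows "avoids_3142 (rot ` rot ` S) \<longleftrightarrow> avoids_3142 S"
proof -
  have "rot ` rot ` rot ` rot ` S = S" by (simp add: image_image)
  then show ?thesis unfolding avoids_3142_def by (metis occ_3142_half_turn)
qed

locale rotation_invariant =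
  fixes S :: "('a::linordered_idom \<times> 'a) set"
  assumes finite_S: "finite S"
    and inj_fst: "inj_on fst S"
    and rot_mem: "s \<in> S \<Longrightarrow> rot s \<in> S"
begin

lemma rot_pair_mem: "(x, y) \<in> S \<Longrightarrow> (y, - x) \<in> S"
  using rot_mem by (force simp: rot_def)

lemma half_turn_mem: "(x, y) \<in> S \<Longrightarrow> (- x, - y) \<in> S"
  using rot_pair_mem by blast

lemma rot_image: "rot ` S = S"
  using finite_S rot_mem by (intro card_subset_eq card_image inj_on_rot) auto

lemma snd_unique: "(x, y) \<in> S \<Longrightarrow> (x, y') \<in> S \<Longrightarrow> y = y'"
  using inj_onD[OF inj_fst, of "(x, y)" "(x, y')"] by simp

lemma inj_snd: "inj_on snd S"
proof -
  have "inj_on (fst \<circ> rot) S"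
    using inj_fst inj_on_rot by (intro comp_inj_on) (simp_all add: rot_image)
  moreover have "fst \<circ> rot = (snd :: 'a \<times> 'a \<Rightarrow> 'a)" by auto
  ultimately show ?thesis by simp
qed

lemma snd_image: "snd ` S = fst ` S"
  using arg_cong[OF rot_image, of "image fst"] by (simp add: image_image)

lemma uminus_fst_image: "uminus ` fst ` S = fst ` S"
  using arg_cong[OF rot_image, of "image snd"] by (simp add: image_image snd_image)

lemma rotation_invariant_hflip: "rotation_invariant (hflip ` S)"
proof
  show "finite (hflip ` S)" by (simp add: finite_S)
  show "inj_on fst (hflip ` S)" using inj_fst by (auto simp: inj_on_def)
  show "rot s \<in> hflip ` S" if "s \<in> hflip ` S" for s
    using that by (auto simp del: split_paired_All simp: rot_hflip intro!: imageI rot_mem)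
qed

lemma central_occ_3142:
  assumes "(x, a) \<in> S" "0 < x" "x < a" and central: "\<And>s. s \<in> S \<Longrightarrow> x \<le> \<bar>fst s\<bar>"
  shows "occ_3142 S (- a, x) (- x, - a) (x, a) (a, - x)"
proof -
  have "(a, - x) \<in> S" "(- x, - a) \<in> S" "(- a, x) \<in> S"
    using assms(1) rot_pair_mem[OF half_turn_mem[OF assms(1)]]
    by (auto intro: rot_pair_mem half_turn_mem)
  moreover have "\<not> (- x < fst s \<and> fst s < x)" if "s \<in> S" for s
    using central[OF that] by linarith
  ultimately show ?thesis
    using assms(1-3) unfolding occ_3142_def by auto
qed

lemma central_point_exists:
  assumes "S \<noteq> {}" "0 \<notin> fst ` S"
  obtains x a where "(x, a) \<in> S" "0 < x" "x < \<bar>a\<bar>" "\<And>s. s \<in> S \<Longrightarrow> x \<le> \<bar>fst s\<bar>"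
proof -
  define x where "x = Min (abs ` fst ` S)"
  have central: "x \<le> \<bar>fst s\<bar>" if "s \<in> S" for s
    using that finite_S by (simp add: x_def)
  have "x \<in> abs ` fst ` S" unfolding x_def using assms(1) finite_S by (intro Min_in) auto
  then obtain y where y: "y \<in> fst ` S" "x = \<bar>y\<bar>" by blast
  then have "0 < x" using assms(2) by auto
  have "x \<in> fst ` S" using y imageI[OF y(1), of uminus] uminus_fst_image by (auto simp: abs_if)
  then obtain a where a: "(x, a) \<in> S" by auto
  have "a \<noteq> x"
    using snd_unique[OF a, of "- x"] rot_pair_mem[OF a] \<open>0 < x\<close> by auto
  moreover have "a \<noteq> - x"
    using snd_unique[OF a, of x] rot_pair_mem[OF half_turn_mem[OF a]] \<open>0 < x\<close> by auto
  moreover have "x \<le> \<bar>a\<bar>" using central[OF rot_mem[OF a]] by simp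
  ultimately have "x < \<bar>a\<bar>" by (auto simp: order_le_less abs_if split: if_splits)
  then show ?thesis using that a \<open>0 < x\<close> central by blast
qed

lemma origin_mem_if_avoids_3142:
  assumes "S \<noteq> {}" "avoids_3142 S" "avoids_3142 (hflip ` S)"
  shows "(0, 0) \<in> S"
proof (cases "0 \<in> fst ` S")
  case True
  then obtain y where y: "(0, y) \<in> S" by auto
  then have "(0, - y) \<in> S" using half_turn_mem[of 0 y] by simp
  then have "y = 0" using snd_unique[OF y, of "- y"] by simp
  with y show ?thesis by simp
next
  case False
  interpret flip: rotation_invariant "hflip ` S" by (fact rotation_invariant_hflip)
  obtain x a where a: "(x, a) \<in> S" and "0 < x" and "x < \<bar>a\<bar>"
    and central: "\<And>s. s \<in> S \<Longrightarrow> x \<le> \<bar>fst s\<bar>"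
    using central_point_exists[OF assms(1) False] by blast
  then consider (above) "x < a" | (below) "x < - a" by linarith
  then show ?thesis
  proof cases
    case above
    from central_occ_3142[OF a \<open>0 < x\<close> this central] avoids_3142D[OF assms(2)]
    show ?thesis by blast
  next
    case below
    have "(x, - a) \<in> hflip ` S"
      using imageI[OF half_turn_mem[OF a], of hflip] by (simp add: hflip_def)
    moreover have "x \<le> \<bar>fst s\<bar>" if "s \<in> hflip ` S" for s
      using that central by auto
    ultimately show ?thesis
      using flip.central_occ_3142[OF _ \<open>0 < x\<close> below] avoids_3142D[OF assms(3)] by blast
  qed
qed

end

subsection \<open>Framing a rotation-invariant set\<close>

definition frame_points :: "'a::group_add \<Rightarrow> 'a \<Rightarrow> ('a \<times> 'a) set" where
  "frame_points m t = {(t, m), (m, - t), (- t, - m), (- m, t)}"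

lemma hflip_frame_points: "hflip ` frame_points m t = frame_points m (- t)"
  by (auto simp: frame_points_def hflip_def)

locale framing = rotation_invariant S
  for S :: "('a::linordered_idom \<times> 'a) set" +
  fixes m t :: 'a
  assumes bounded: "s \<in> S \<Longrightarrow> \<bar>fst s\<bar> < m"
    and origin_mem: "(0, 0) \<in> S"
    and t_bound: "\<bar>t\<bar> < m"
    and t_new: "t \<notin> fst ` S"
begin

abbreviation "north \<equiv> (t, m)"
abbreviation "east \<equiv> (m, - t)"
abbreviation "south \<equiv> (- t, - m)"
abbreviation "west \<equiv> (- m, t)"

abbreviation "framed \<equiv> S \<union> frame_points m t"

lemma snd_bounded: "s \<in> S \<Longrightarrow> \<bar>snd s\<bar> < m"
  using bounded[OF rot_mem] by simp

lemma t_nonzero: "t \<noteq> 0"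
  using t_new origin_mem by force

lemma uminus_t_new: "- t \<notin> fst ` S"
  using t_new imageI[of "- t" "fst ` S" uminus] by (auto simp: uminus_fst_image)

lemma disjoint_frame: "S \<inter> frame_points m t = {}"
  using bounded snd_bounded by (fastforce simp: frame_points_def)

lemma framed_bounded:
  assumes "s \<in> framed"
  shows "- m \<le> fst s" "fst s \<le> m" "- m \<le> snd s" "snd s \<le> m"
  using assms bounded[of s] snd_bounded[of s] t_bound by (auto simp: frame_points_def)

lemma card_framed: "card framed = card S + 4"
proof -
  have "finite (frame_points m t)" "card (frame_points m t) = 4"
    using t_bound t_nonzero by (auto simp: frame_points_def)
  then show ?thesis
    by (simp add: card_Un_disjoint finite_S disjoint_frame)
qed

lemma rotation_invariant_framed: "rotation_invariant framed"
proof
  show "finite framed" by (simp add: finite_S frame_points_def)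
  show "inj_on fst framed"
    using inj_fst t_bound t_nonzero t_new uminus_t_new bounded
    by (simp add: inj_on_Un frame_points_def) (force simp: image_iff)
  show "rot s \<in> framed" if "s \<in> framed" for s
    using that rot_mem by (auto simp: frame_points_def rot_def)
qed

lemma framing_hflip: "framing (hflip ` S) m (- t)"
proof (intro framing.intro framing_axioms.intro rotation_invariant_hflip)
  show "(0, 0) \<in> hflip ` S" using imageI[OF origin_mem, of hflip] by (simp add: hflip_def)
  show "\<bar>- t\<bar> < m" using t_bound by simp
  show "- t \<notin> fst ` hflip ` S" using t_new by (auto simp: image_iff)
qed (auto dest: bounded)

lemma card_left_eq_card_below: "card {s \<in> S. fst s < t} = card {s \<in> S. snd s < t}"
proof -
  have "rot ` {s \<in> S. snd s < t} = {s \<in> rot ` S. fst s < t}" by auto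
  then have "{s \<in> S. fst s < t} = rot ` {s \<in> S. snd s < t}" by (simp add: rot_image)
  then show ?thesis by (simp add: card_image inj_on_rot)
qed

lemma tight_framed_rot:
  "tight_3142 framed a b c d \<Longrightarrow> tight_3142 framed (rot b) (rot d) (rot a) (rot c)"
  using tight_3142_rot[of framed a b c d]
    rotation_invariant.rot_image[OF rotation_invariant_framed] by simp

lemma tight_framed_parts:
  assumes "tight_3142 framed a b c d"
  shows "a \<in> insert west S" "b \<in> insert south S" "c \<in> insert north S" "d \<in> insert east S"
    and "\<not> (a = west \<and> d = east)"
proof -
  note tight = assms[unfolded tight_3142_def occ_3142_def]
  have mem: "a \<in> framed" "b \<in> framed" "c \<in> framed" "d \<in> framed" using tight by auto
  have "a \<notin> {north, east, south}"
    using tight framed_bounded[OF mem(2)] framed_bounded[OF mem(3)] by auto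
  moreover have "b \<notin> {north, east, west}"
    using tight framed_bounded[OF mem(1)] framed_bounded[OF mem(3)] by auto
  moreover have "c \<notin> {east, south, west}"
    using tight framed_bounded[OF mem(2)] framed_bounded[OF mem(4)] by auto
  moreover have "d \<notin> {north, south, west}"
    using tight framed_bounded[OF mem(2)] framed_bounded[OF mem(3)] by auto
  ultimately show "a \<in> insert west S" "b \<in> insert south S" "c \<in> insert north S" "d \<in> insert east S"
    using mem by (auto simp: frame_points_def)
  show "\<not> (a = west \<and> d = east)"
    using tight origin_mem by force
qed

end

locale avoiding_framing = framing +
  assumes avoids_S: "avoids_3142 S"
    and avoids_insert_north: "avoids_3142 (insert north S)"
begin

lemma below_if_left_of_tight_north:
  assumes occ: "occ_3142 framed a b north d" and "b \<in> S" "d \<in> S" and s: "s \<in> S" "fst s < fst b"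
  shows "snd s < snd d"
proof (rule ccontr)
  assume "\<not> snd s < snd d"
  moreover have "snd s \<noteq> snd d"
    using inj_onD[OF inj_snd _ s(1) \<open>d \<in> S\<close>] s(2) occ by (auto simp: occ_3142_def)
  ultimately have "occ_3142 (insert north S) s b north d"
    using assms snd_bounded[OF s(1)] by (auto simp: occ_3142_def)
  then show False using avoids_3142D[OF avoids_insert_north] by blast
qed

lemma tight_north_imp_east:
  assumes tight: "tight_3142 framed a b north d"
  shows "d = east"
proof (rule ccontr)
  assume "d \<noteq> east"
  note occ = tight[unfolded tight_3142_def, THEN conjunct1]
  note ord = occ[unfolded occ_3142_def]
  have "b \<noteq> south" using ord t_nonzero origin_mem by force
  with \<open>d \<noteq> east\<close> have mem: "b \<in> S" "d \<in> S" using tight_framed_parts[OF tight] by auto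
  note below_d = below_if_left_of_tight_north[OF occ mem]
  have "a \<notin> S" using below_d[of a] ord by auto
  then have a_west: "a = west" using tight_framed_parts(1)[OF tight] by simp
  have "snd s < t" if s: "s \<in> S" "fst s < t" for s
  proof -
    have "fst s \<le> fst b" using ord s by force
    then consider "s = b" | "fst s < fst b"
      using inj_onD[OF inj_fst _ s(1) mem(1)] by force
    then show ?thesis using below_d[OF s(1)] ord a_west by cases auto
  qed
  then have "{s \<in> S. fst s < t} \<subseteq> {s \<in> S. snd s < t}" by auto
  then have "{s \<in> S. fst s < t} = {s \<in> S. snd s < t}"
    using card_left_eq_card_below finite_S by (intro card_subset_eq) auto
  moreover have "snd d < t" "t < fst d" using ord a_west by auto
  ultimately show False using mem(2) by force
qed

lemma tight_neq_west:
  assumes tight: "tight_3142 framed a b c d"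
  shows "a \<noteq> west"
proof
  assume a_west: "a = west"
  then have "rot c = east"
    using tight_north_imp_east[of "rot b" "rot d" "rot c"] tight_framed_rot[OF tight]
    by (simp add: rot_def)
  then have "c = north" by (simp add: rot_def prod_eq_iff)
  then have "d = east" using tight_north_imp_east tight by blast
  with a_west show False using tight_framed_parts(5)[OF tight] by simp
qed

lemma avoids_3142_framed: "avoids_3142 framed"
proof (rule ccontr)
  interpret framed: rotation_invariant framed by (fact rotation_invariant_framed)
  assume "\<not> avoids_3142 framed"
  then obtain a b c d where tight: "tight_3142 framed a b c d"
    unfolding avoids_3142_def using tight_3142_exists[OF framed.finite_S framed.inj_fst] by blast
  have not_west: "a \<noteq> west" if "tight_3142 framed a b c d" for a b c d
    using that by (rule tight_neq_west)
  have not_south: "b \<noteq> south" if "tight_3142 framed a b c d" for a b c d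
    using not_west[OF tight_framed_rot[OF that]] by (auto simp: rot_def)
  have not_east: "d \<noteq> east" if "tight_3142 framed a b c d" for a b c d
    using not_south[OF tight_framed_rot[OF that]] by (auto simp: rot_def)
  have not_north: "c \<noteq> north" if "tight_3142 framed a b c d" for a b c d
    using not_east[OF tight_framed_rot[OF that]] by (auto simp: rot_def)
  have "{a, b, c, d} \<subseteq> S"
    using tight_framed_parts[OF tight] not_west[OF tight] not_south[OF tight]
      not_north[OF tight] not_east[OF tight] by auto
  then have "occ_3142 S a b c d"
    using tight by (auto simp: tight_3142_def intro: occ_3142_subset)
  then show False using avoids_3142D[OF avoids_S] by blast
qed

end

lemma (in framing) avoids_3142_framed_and_hflip:
  assumes "avoids_3142 S" "avoids_3142 (hflip ` S)"
    and "avoids_3142 (insert north S)" "avoids_3142 (hflip ` insert north S)"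
  shows "avoids_3142 framed" "avoids_3142 (hflip ` framed)"
proof -
  interpret avoiding_framing S m t using assms by unfold_locales
  show "avoids_3142 framed" by (fact avoids_3142_framed)
  interpret flip: framing "hflip ` S" m "- t" by (fact framing_hflip)
  interpret flip: avoiding_framing "hflip ` S" m "- t"
    using assms(2,4) by unfold_locales (simp_all add: hflip_def)
  show "avoids_3142 (hflip ` framed)"
    using flip.avoids_3142_framed by (simp add: image_Un hflip_frame_points)
qed

subsection \<open>Plots of lists\<close>

definition plot :: "(nat \<Rightarrow> 'a) \<Rightarrow> (nat \<Rightarrow> 'b) \<Rightarrow> nat list \<Rightarrow> ('a \<times> 'b) set" where
  "plot g h w = (\<lambda>i. (g (Suc i), h (w ! i))) ` {..<length w}"

lemma finite_plot: "finite (plot g h w)"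
  by (simp add: plot_def)

lemma fst_plot: "fst ` plot g h w = g ` {1..length w}"
  unfolding plot_def image_Suc_lessThan[symmetric] by (simp add: image_image)

lemma plot_cong:
  assumes "\<And>i. i \<in> {1..length w} \<Longrightarrow> g i = g' i"
  shows "plot g h w = plot g' h w"
  unfolding plot_def using assms by (intro image_cong) auto

lemma plot_append: "plot g h (u @ w) = plot g h u \<union> plot (\<lambda>i. g (length u + i)) h w"
proof -
  have "(+) (length u) ` {..<length w} = {length u..<length (u @ w)}"
    by (simp add: lessThan_atLeast0 add.commute)
  then have "{..<length (u @ w)} = {..<length u} \<union> (+) (length u) ` {..<length w}" by auto
  then show ?thesis
    unfolding plot_def by (simp add: image_Un image_image nth_append)
qed

lemma plot_Cons: "plot g h (x # w) = insert (g 1, h x) (plot (\<lambda>i. g (Suc i)) h w)"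
  by (simp add: plot_def lessThan_Suc_eq_insert_0 image_image)

lemma plot_insert_largest:
  assumes "p \<le> length w"
  shows "plot g h (insert_largest p w) =
    insert (g (Suc p), h (Suc (length w))) (plot (\<lambda>i. if i \<le> p then g i else g (Suc i)) h w)"
    (is "_ = insert _ (plot ?g h w)")
proof -
  have length_take_p: "length (take p w) = p" using assms by simp
  have "plot ?g h w = plot ?g h (take p w @ drop p w)" by simp
  also have "\<dots> = plot ?g h (take p w) \<union> plot (\<lambda>i. ?g (p + i)) h (drop p w)"
    unfolding plot_append length_take_p ..
  also have "plot ?g h (take p w) = plot g h (take p w)"
    using assms by (intro plot_cong) simp
  also have "plot (\<lambda>i. ?g (p + i)) h (drop p w) = plot (\<lambda>i. g (Suc (p + i))) h (drop p w)"
    by (intro plot_cong) simp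
  finally have "plot ?g h w = plot g h (take p w) \<union> plot (\<lambda>i. g (Suc (p + i))) h (drop p w)" .
  moreover have "plot g h (insert_largest p w) =
      plot g h (take p w) \<union> plot (\<lambda>i. g (p + i)) h (Suc (length w) # drop p w)"
    using plot_append[of g h "take p w"] unfolding insert_largest_def length_take_p by simp
  ultimately show ?thesis by (simp add: plot_Cons)
qed

lemma inj_on_fst_plot: "inj_on g {1..length w} \<Longrightarrow> inj_on fst (plot g h w)"
  by (auto simp: plot_def inj_on_eq_iff intro!: inj_onI)

lemma card_plot: "inj_on g {1..length w} \<Longrightarrow> card (plot g h w) = length w"
  by (metis card_image fst_plot inj_on_fst_plot card_atLeastAtMost diff_Suc_1)

lemma mem_plot_iff:
  assumes "inj_on g {1..length w}" "i < length w"
  shows "(g (Suc i), y) \<in> plot g h w \<longleftrightarrow> y = h (w ! i)"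
  using assms by (auto simp: plot_def inj_on_eq_iff)

lemma avoids_3142_plot:
  assumes mono_g: "strict_mono_on {1..length w} g"
  shows "avoids_3142 (plot g h w) \<longleftrightarrow>
    (\<nexists>i j k. i < j \<and> j + 1 < k \<and> k < length w \<and>
      h (w ! j) < h (w ! k) \<and> h (w ! k) < h (w ! i) \<and> h (w ! i) < h (w ! (j + 1)))"
    (is "_ \<longleftrightarrow> (\<nexists>i j k. ?occ i j k)")
proof -
  have coord_less: "g (Suc i) < g (Suc j) \<longleftrightarrow> i < j" if "i < length w" "j < length w" for i j
    using strict_mono_on_less[OF mono_g] that by simp
  have "\<exists>i j k. ?occ i j k" if occ: "occ_3142 (plot g h w) a b c d" for a b c d
  proof -
    obtain i j j' k where bound: "i < length w" "j < length w" "j' < length w" "k < length w"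
      and points: "a = (g (Suc i), h (w ! i))" "b = (g (Suc j), h (w ! j))"
        "c = (g (Suc j'), h (w ! j'))" "d = (g (Suc k), h (w ! k))"
      using occ by (auto simp: occ_3142_def plot_def)
    have index_less: "i < j" "j < j'" "j' < k"
      and value_less: "h (w ! j) < h (w ! k)" "h (w ! k) < h (w ! i)" "h (w ! i) < h (w ! j')"
      using occ bound by (simp_all add: occ_3142_def points coord_less)
    have "(g (Suc (j + 1)), h (w ! (j + 1))) \<in> plot g h w"
      using bound index_less unfolding plot_def by (intro imageI) simp
    then have "\<not> (g (Suc j) < g (Suc (j + 1)) \<and> g (Suc (j + 1)) < g (Suc j'))"
      using occ unfolding occ_3142_def points by fastforce
    then have "j' = j + 1" using bound index_less by (auto simp: coord_less)
    then show ?thesis using index_less value_less bound by blast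
  qed
  moreover have "\<exists>a b c d. occ_3142 (plot g h w) a b c d" if "?occ i j k" for i j k
  proof -
    let ?pt = "\<lambda>l. (g (Suc l), h (w ! l))"
    have "{?pt i, ?pt j, ?pt (j + 1), ?pt k} \<subseteq> plot g h w"
      using that unfolding plot_def by (auto intro: imageI)
    moreover have "\<forall>e\<in>plot g h w. \<not> (g (Suc j) < fst e \<and> fst e < g (Suc (j + 1)))"
      using that by (auto simp: plot_def coord_less)
    ultimately have "occ_3142 (plot g h w) (?pt i) (?pt j) (?pt (j + 1)) (?pt k)"
      unfolding occ_3142_def using that by (simp add: coord_less)
    then show ?thesis by blast
  qed
  ultimately show ?thesis unfolding avoids_3142_def by meson
qed

lemma baxter_iff_avoids_3142:
  fixes g h :: "nat \<Rightarrow> 'a::linordered_ab_group_add"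
  assumes mono_g: "strict_mono_on {1..length w} g" and mono_h: "strict_mono_on (set w) h"
  shows "baxter w \<longleftrightarrow> avoids_3142 (plot g h w) \<and> avoids_3142 (hflip ` plot g h w)"
proof -
  have value_less: "h (w ! i) < h (w ! j) \<longleftrightarrow> w ! i < w ! j" if "i < length w" "j < length w" for i j
    using strict_mono_on_less[OF mono_h] that by simp
  \<comment> \<open>Half turns preserve 3-14-2, so complementing the values may replace reversing the positions.\<close>
  have "rot ` rot ` hflip ` plot g h w = plot g (\<lambda>u. - h u) w"
    by (simp add: plot_def image_image rot_def hflip_def)
  then have "avoids_3142 (hflip ` plot g h w) \<longleftrightarrow> avoids_3142 (plot g (\<lambda>u. - h u) w)"
    by (metis avoids_3142_half_turn)
  also have "\<dots> \<longleftrightarrow> (\<nexists>i j k. i < j \<and> j + 1 < k \<and> k < length w \<and>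
      w ! (j + 1) < w ! i \<and> w ! i < w ! k \<and> w ! k < w ! j)"
    unfolding avoids_3142_plot[OF mono_g] by (intro arg_cong[where f = Not] ex_cong1)
      (auto simp: value_less)
  finally have "avoids_3142 (hflip ` plot g h w) \<longleftrightarrow> \<dots>" .
  moreover have "avoids_3142 (plot g h w) \<longleftrightarrow> (\<nexists>i j k. i < j \<and> j + 1 < k \<and> k < length w \<and>
      w ! j < w ! k \<and> w ! k < w ! i \<and> w ! i < w ! (j + 1))"
    unfolding avoids_3142_plot[OF mono_g] by (intro arg_cong[where f = Not] ex_cong1)
      (auto simp: value_less)
  ultimately show ?thesis unfolding baxter_def by blast
qed

subsection \<open>Rotation-fixed permutations\<close>

lemma permutations_of_upto_D:
  assumes "w \<in> permutations_of_set {1..n}"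
  shows "length w = n" "set w = {1..n}" "distinct w"
    and "i < n \<Longrightarrow> 1 \<le> w ! i \<and> w ! i \<le> n"
proof -
  show "length w = n" using assms length_finite_permutations_of_set by force
  then show "1 \<le> w ! i \<and> w ! i \<le> n" if "i < n"
    using permutations_of_setD(1)[OF assms] that nth_mem[of i w] by simp
qed (use permutations_of_setD[OF assms] in simp_all)

lemma rotation_fixed_iff_rot_plot:
  fixes g :: "nat \<Rightarrow> 'a::group_add"
  assumes perm: "w \<in> permutations_of_set {1..n}" and inj_g: "inj_on g {1..n}"
    and neg: "\<And>i. i < n \<Longrightarrow> g (n - i) = - g (Suc i)"
  shows "rotation_fixed w \<longleftrightarrow> rot ` plot g g w \<subseteq> plot g g w"
proof -
  note w_perm = permutations_of_upto_D[OF perm]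
  have rot_mem_plot_iff: "(g (w ! i), - g (Suc i)) \<in> plot g g w \<longleftrightarrow> w ! (w ! i - 1) = n - i"
    if "i < n" for i
  proof -
    have bound: "Suc (w ! i - 1) = w ! i" "w ! i - 1 < n" using w_perm(4)[OF that] by auto
    then have "(g (w ! i), - g (Suc i)) \<in> plot g g w \<longleftrightarrow> g (n - i) = g (w ! (w ! i - 1))"
      using mem_plot_iff[of g w "w ! i - 1" "- g (Suc i)" g] inj_g w_perm(1) neg[OF that] by simp
    also have "\<dots> \<longleftrightarrow> n - i = w ! (w ! i - 1)"
      using that w_perm(4)[OF bound(2)] by (intro inj_on_eq_iff[OF inj_g]) auto
    finally show ?thesis by auto
  qed
  have "rotation_fixed w \<longleftrightarrow> (\<forall>i\<in>Suc ` {..<n}. w ! (w ! (i - 1) - 1) = n + 1 - i)"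
    unfolding rotation_fixed_def image_Suc_lessThan w_perm(1) using w_perm(4) by force
  also have "\<dots> \<longleftrightarrow> (\<forall>i<n. w ! (w ! i - 1) = n - i)" by auto
  also have "\<dots> \<longleftrightarrow> rot ` plot g g w \<subseteq> plot g g w"
    unfolding plot_def[of _ _ w, THEN arg_cong, of "image rot"] image_image image_subset_iff
    using rot_mem_plot_iff w_perm(1) by (auto simp: rot_def)
  finally show ?thesis .
qed

lemma rotation_invariant_plot:
  fixes g :: "nat \<Rightarrow> 'a::linordered_idom"
  assumes perm: "w \<in> permutations_of_set {1..n}" and inj_g: "inj_on g {1..n}"
    and neg: "\<And>i. i < n \<Longrightarrow> g (n - i) = - g (Suc i)" and "rotation_fixed w"
  shows "rotation_invariant (plot g g w)"
proof
  show "finite (plot g g w)" by (rule finite_plot)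
  show "inj_on fst (plot g g w)"
    using inj_g permutations_of_upto_D(1)[OF perm] by (simp add: inj_on_fst_plot)
  show "rot s \<in> plot g g w" if "s \<in> plot g g w" for s
    using rotation_fixed_iff_rot_plot[OF perm inj_g neg] assms(4) that by blast
qed

lemma perm_plot_exists:
  assumes inj: "inj_on fst S" "inj_on snd S"
    and bij_g: "bij_betw g {1..n} (fst ` S)" and bij_h: "bij_betw h {1..n} (snd ` S)"
  shows "\<exists>w\<in>permutations_of_set {1..n}. plot g h w = S"
proof -
  define pt where "pt = inv_into S fst \<circ> (g \<circ> Suc)"
  have "bij_betw Suc {..<n} {1..n}"
    by (simp add: bij_betw_def image_Suc_lessThan)
  then have bij_g_Suc: "bij_betw (g \<circ> Suc) {..<n} (fst ` S)" using bij_g by (rule bij_betw_trans)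
  then have bij_pt: "bij_betw pt {..<n} S"
    unfolding pt_def
    by (rule bij_betw_trans) (simp add: bij_betw_inv_into inj(1) inj_on_imp_bij_betw)
  define k where "k = inv_into {1..n} h \<circ> (snd \<circ> pt)"
  have "bij_betw (snd \<circ> pt) {..<n} (snd ` S)"
    using bij_pt inj(2) by (auto intro: bij_betw_trans inj_on_imp_bij_betw)
  then have bij_k: "bij_betw k {..<n} {1..n}"
    unfolding k_def using bij_betw_inv_into[OF bij_h] by (rule bij_betw_trans)
  have pt_eq: "(g (Suc i), h (k i)) = pt i" if "i < n" for i
  proof -
    have "fst (pt i) = g (Suc i)"
      using bij_betwE[OF bij_g_Suc] that by (simp add: pt_def f_inv_into_f)
    moreover have "h (k i) = snd (pt i)"
      using bij_betwE[OF bij_pt] that bij_betw_inv_into_right[OF bij_h] by (simp add: k_def)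
    ultimately show ?thesis by (simp add: prod_eq_iff)
  qed
  let ?w = "map k [0..<n]"
  have "?w \<in> permutations_of_set {1..n}"
    using bij_k by (simp add: permutations_of_set_def distinct_map bij_betw_def lessThan_atLeast0)
  moreover have "plot g h ?w = pt ` {..<n}"
    unfolding plot_def by (intro image_cong) (simp_all add: pt_eq)
  ultimately show ?thesis using bij_betw_imp_surj_on[OF bij_pt] by blast
qed

lemma strict_mono_enumeration_exists:
  fixes X :: "'a::linorder set"
  assumes "finite X"
  obtains g where "strict_mono_on {1..card X} g" "g ` {1..card X} = X"
proof
  let ?g = "\<lambda>i. sorted_list_of_set X ! (i - 1)"
  show "strict_mono_on {1..card X} ?g"
    using sorted_wrt_nth_less[OF strict_sorted_list_of_set[of X]]
    by (auto simp: strict_mono_on_def)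
  have "?g ` Suc ` {..<card X} = set (sorted_list_of_set X)"
    by (auto simp: image_image set_conv_nth)
  then show "?g ` {1..card X} = X" using assms by (simp add: image_Suc_lessThan)
qed

lemma strict_mono_on_image_unique:
  fixes f g :: "nat \<Rightarrow> 'a::linorder"
  assumes mono_f: "strict_mono_on {1..n} f" and mono_g: "strict_mono_on {1..n} g"
    and image: "f ` {1..n} = g ` {1..n}" and "i \<in> {1..n}"
  shows "f i = g i"
proof -
  have sorted_map: "sorted (map h [1..<Suc n]) \<and> distinct (map h [1..<Suc n])"
    if "strict_mono_on {1..n} h" for h :: "nat \<Rightarrow> 'a"
    using that by (auto simp: sorted_wrt_map distinct_map strict_mono_on_imp_inj_on
      atLeastLessThanSuc_atLeastAtMost strict_mono_on_leD simp del: upt_Suc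
      intro!: sorted_wrt_mono_rel[OF _ sorted_upt])
  have "map f [1..<Suc n] = map g [1..<Suc n]"
    using sorted_map[OF mono_f] sorted_map[OF mono_g] image
    by (intro sorted_distinct_set_unique)
      (simp_all add: atLeastLessThanSuc_atLeastAtMost del: upt_Suc)
  then show ?thesis using assms(4) by (simp del: upt_Suc)
qed

context rotation_invariant
begin

lemma rotation_fixed_perm_exists:
  obtains w g where "w \<in> permutations_of_set {1..card S}" "rotation_fixed w"
    and "strict_mono_on {1..card S} g" "plot g g w = S"
proof -
  define n where "n = card S"
  have "card (fst ` S) = n" by (simp add: n_def card_image inj_fst)
  then obtain g where enum: "strict_mono_on {1..n} g" "g ` {1..n} = fst ` S"
    using strict_mono_enumeration_exists[of "fst ` S"] finite_S by auto
  note inj_g = strict_mono_on_imp_inj_on[OF enum(1)]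
  obtain w where w: "w \<in> permutations_of_set {1..n}" "plot g g w = S"
    using perm_plot_exists[OF inj_fst inj_snd, of g n g] enum(2) inj_g
    by (auto simp: snd_image bij_betw_def)
  have reverse: "(\<lambda>i. n + 1 - i) ` {1..n} = {1..n}"
    by (rule bij_betw_imp_surj_on, rule bij_betw_byWitness[where f' = "\<lambda>i. n + 1 - i"]) auto
  have "strict_mono_on {1..n} (\<lambda>i. - g (n + 1 - i))"
    using strict_mono_onD[OF enum(1)] by (intro strict_mono_onI) simp
  moreover have "(\<lambda>i. - g (n + 1 - i)) ` {1..n} = g ` {1..n}"
    using uminus_fst_image enum(2) reverse by (metis image_image)
  ultimately have neg: "g i = - g (n + 1 - i)" if "i \<in> {1..n}" for i
    using strict_mono_on_image_unique[OF enum(1)] that by metis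
  have "g (n - i) = - g (Suc i)" if "i < n" for i
    using neg[of "Suc i"] that by simp
  then have "rotation_fixed w"
    using rotation_fixed_iff_rot_plot[OF w(1) inj_g] by (simp add: w(2) rot_image)
  then show ?thesis using that enum(1) w by (simp add: n_def)
qed

end

subsection \<open>Deleting the frame\<close>

lemma standardize_eqI:
  assumes perm: "w \<in> permutations_of_set {1..n}" and length_ys: "length ys = n"
    and order_iso: "\<And>i j. i < n \<Longrightarrow> j < n \<Longrightarrow> ys ! i \<le> ys ! j \<longleftrightarrow> w ! i \<le> w ! j"
  shows "standardize ys = w"
proof (rule nth_equalityI)
  note w_perm = permutations_of_upto_D[OF perm]
  show "length (standardize ys) = length w" using w_perm length_ys by (simp add: standardize_def)
  fix i assume "i < length (standardize ys)"
  then have i: "i < n" using length_ys by (simp add: standardize_def)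
  let ?I = "{j \<in> {..<n}. w ! j \<le> w ! i}"
  have inj_w: "inj_on (nth w) {..<n}" using w_perm by (intro inj_on_nth) auto
  then have inj_ys: "inj_on (nth ys) {..<n}"
    using order_iso by (simp add: inj_on_def order_eq_iff)
  have "{y \<in> set ys. y \<le> ys ! i} = nth ys ` ?I"
    using order_iso length_ys i by (auto simp: set_conv_nth)
  then have "card {y \<in> set ys. y \<le> ys ! i} = card ?I"
    using card_image[OF inj_on_subset[OF inj_ys, of ?I]] by auto
  also have "\<dots> = card (nth w ` ?I)"
    using inj_w by (subst card_image) (auto intro: inj_on_subset)
  also have "nth w ` ?I = {x \<in> set w. x \<le> w ! i}"
    using w_perm(1) by (auto simp: set_conv_nth)
  also have "\<dots> = {1..w ! i}" using w_perm(2) w_perm(4)[OF i] by auto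
  finally show "standardize ys ! i = w ! i"
    using i length_ys by (simp add: standardize_def)
qed

lemma standardize_eq_if_plot_eq:
  fixes c g :: "nat \<Rightarrow> 'a::linorder" and d h :: "nat \<Rightarrow> 'b::linorder"
  assumes perm: "w \<in> permutations_of_set {1..n}"
    and mono_c: "strict_mono_on {1..n} c" and mono_d: "strict_mono_on {1..n} d"
    and mono_g: "strict_mono_on {1..length ys} g" and mono_h: "strict_mono_on (set ys) h"
    and plot_eq: "plot c d w = plot g h ys"
  shows "standardize ys = w"
proof -
  note w_perm = permutations_of_upto_D[OF perm]
  have image: "c ` {1..n} = g ` {1..length ys}"
    using fst_plot[of c d w] fst_plot[of g h ys] by (simp add: plot_eq w_perm(1))
  have length_ys: "length ys = n"
    using arg_cong[OF image, of card] mono_c mono_g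
    by (simp add: card_image strict_mono_on_imp_inj_on)
  have coord_eq: "c (Suc i) = g (Suc i)" if "i < n" for i
    using strict_mono_on_image_unique[OF mono_c, of g "Suc i"] mono_g image that
    by (simp add: length_ys)
  have value_eq: "h (ys ! i) = d (w ! i)" if i: "i < n" for i
  proof -
    have "(c (Suc i), d (w ! i)) \<in> plot g h ys"
      using i w_perm(1) unfolding plot_eq[symmetric] by (auto simp: plot_def)
    then show ?thesis
      using mem_plot_iff[OF strict_mono_on_imp_inj_on[OF mono_g], of i "d (w ! i)" h] i
      by (simp add: length_ys coord_eq)
  qed
  show ?thesis
  proof (rule standardize_eqI[OF perm length_ys])
    fix i j assume ij: "i < n" "j < n"
    then have "ys ! i \<le> ys ! j \<longleftrightarrow> h (ys ! i) \<le> h (ys ! j)"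
      using strict_mono_on_less_eq[OF mono_h] length_ys by simp
    also have "\<dots> \<longleftrightarrow> w ! i \<le> w ! j"
      using strict_mono_on_less_eq[OF mono_d] w_perm(4) ij by (simp add: value_eq)
    finally show "ys ! i \<le> ys ! j \<longleftrightarrow> w ! i \<le> w ! j" .
  qed
qed

lemma plot_filter_exists:
  assumes mono_g: "strict_mono_on {1..length v} g"
  obtains g' where "strict_mono_on {1..length (filter P v)} g'"
    and "plot g' h (filter P v) = (\<lambda>i. (g (Suc i), h (v ! i))) ` {i. i < length v \<and> P (v ! i)}"
proof
  define js where "js = filter (\<lambda>i. P (v ! i)) [0..<length v]"
  have set_js: "set js = {i. i < length v \<and> P (v ! i)}" by (auto simp: js_def)
  have js_less: "js ! i < js ! j" if "i < j" "j < length js" for i j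
    using sorted_wrt_nth_less[OF _ that, of "(<)"] by (simp add: js_def sorted_wrt_filter)
  have js_bound: "js ! i < length v" if "i < length js" for i
    using nth_mem[OF that] by (simp add: set_js)
  have "filter P v = filter P (map (nth v) [0..<length v])" by (simp add: map_nth)
  then have filter_eq: "filter P v = map (nth v) js" by (simp add: js_def filter_map comp_def)
  let ?g = "\<lambda>i. g (Suc (js ! (i - 1)))"
  show "strict_mono_on {1..length (filter P v)} ?g"
    unfolding filter_eq using js_less js_bound
    by (intro strict_mono_onI strict_mono_onD[OF mono_g]) (auto simp: Suc_le_eq)
  have "plot ?g h (filter P v) = (\<lambda>i. (g (Suc i), h (v ! i))) ` nth js ` {..<length js}"
    unfolding plot_def filter_eq image_image by (intro image_cong) auto
  also have "nth js ` {..<length js} = set js" by (auto simp: set_conv_nth)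
  finally show "plot ?g h (filter P v) =
      (\<lambda>i. (g (Suc i), h (v ! i))) ` {i. i < length v \<and> P (v ! i)}"
    unfolding set_js .
qed

lemma Max_set_permutation:
  fixes n :: nat
  shows "v \<in> permutations_of_set {1..n} \<Longrightarrow> 0 < n \<Longrightarrow> Max (set v) = n"
  by (intro Max_eqI) (auto simp: permutations_of_setD(1))

lemma inner_entry_nth_iff:
  assumes perm: "v \<in> permutations_of_set {1..n}" and i: "i < n"
  shows "inner_entry v (v ! i) \<longleftrightarrow> Suc i \<notin> {1, n} \<and> v ! i \<notin> {1, n}"
proof -
  note v_perm = permutations_of_upto_D[OF perm]
  have "Min (set v) = 1" "Max (set v) = n"
    using i Max_set_permutation[OF perm] by (auto simp: v_perm(2) Min_eq_iff)
  moreover have "hd v = v ! 0" "last v = v ! (n - 1)"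
    using i v_perm(1) by (simp_all add: hd_conv_nth last_conv_nth flip: length_greater_0_conv)
  ultimately show ?thesis
    using i v_perm(1,3) by (auto simp: inner_entry_def nth_eq_iff_index_eq)
qed

lemma largest_gap_eq_card:
  assumes perm: "v \<in> permutations_of_set {1..n}" and q: "q < n" "v ! q = n"
  shows "largest_gap v = card {i. i < q \<and> inner_entry v (v ! i)}"
proof -
  note v_perm = permutations_of_upto_D[OF perm]
  have "takeWhile (\<lambda>x. x \<noteq> Max (set v)) v = take q v"
  proof (rule takeWhile_eq_take_P_nth)
    fix i assume "i < q" "i < length v"
    then have "v ! i \<noteq> v ! q" using v_perm(1,3) q(1) by (simp add: nth_eq_iff_index_eq)
    then show "v ! i \<noteq> Max (set v)" using Max_set_permutation[OF perm] q by simp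
  qed (use Max_set_permutation[OF perm] q in simp)
  then show ?thesis
    using q(1) v_perm(1)
    by (auto simp: largest_gap_def length_filter_conv_card intro: arg_cong[where f = card])
qed

context framing
begin

lemma frame_coords:
  fixes g :: "nat \<Rightarrow> 'a" and n :: nat
  assumes mono_g: "strict_mono_on {1..n} g" and image: "g ` {1..n} = fst ` framed"
  shows "g 1 = - m" "g n = m"
proof -
  have bound: "- m \<le> g i \<and> g i \<le> m" if i: "i \<in> {1..n}" for i
  proof -
    obtain s where "s \<in> framed" "g i = fst s"
      using imageI[OF i, of g] unfolding image by blast
    then show ?thesis using framed_bounded by simp
  qed
  have "fst west \<in> g ` {1..n}" "fst east \<in> g ` {1..n}"
    unfolding image by (intro imageI; simp add: frame_points_def)+
  then obtain i j where "i \<in> {1..n}" "g i = - m" "j \<in> {1..n}" "g j = m"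
    by (metis imageE fst_conv)
  then show "g 1 = - m" "g n = m"
    using strict_mono_on_leD[OF mono_g, of 1 i] strict_mono_on_leD[OF mono_g, of j n]
      bound[of 1] bound[of n]
    by auto
qed

context
  fixes v :: "nat list" and n :: nat and g :: "nat \<Rightarrow> 'a"
  assumes perm: "v \<in> permutations_of_set {1..n}"
    and mono_g: "strict_mono_on {1..n} g"
    and plot: "plot g g v = framed"
begin

private lemmas v_perm = permutations_of_upto_D[OF perm]

lemma inner_entry_iff_mem:
  assumes i: "i < n"
  shows "inner_entry v (v ! i) \<longleftrightarrow> (g (Suc i), g (v ! i)) \<in> S"
proof -
  have ends: "g 1 = - m" "g n = m"
    using frame_coords[OF mono_g] fst_plot[of g g v] by (simp_all add: plot v_perm(1))
  have "g j \<in> {- m, m} \<longleftrightarrow> j \<in> {1, n}" if "j \<in> {1..n}" for j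
    using strict_mono_on_eq[OF mono_g that, of 1, unfolded ends(1)]
      strict_mono_on_eq[OF mono_g that, of n, unfolded ends(2)] i by auto
  then have "inner_entry v (v ! i) \<longleftrightarrow> g (Suc i) \<notin> {- m, m} \<and> g (v ! i) \<notin> {- m, m}"
    using inner_entry_nth_iff[OF perm i] i v_perm(4)[OF i] by simp
  also have "\<dots> \<longleftrightarrow> (g (Suc i), g (v ! i)) \<in> S"
  proof -
    have "(g (Suc i), g (v ! i)) \<in> framed"
      using i v_perm(1) unfolding plot[symmetric] by (auto simp: plot_def)
    then show ?thesis using bounded snd_bounded by (fastforce simp: frame_points_def)
  qed
  finally show ?thesis .
qed

lemma image_inner_entries:
  "(\<lambda>i. (g (Suc i), g (v ! i))) ` {i. i < n \<and> inner_entry v (v ! i)} = S"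
proof -
  have "(\<lambda>i. (g (Suc i), g (v ! i))) ` {i. i < n \<and> inner_entry v (v ! i)} = plot g g v \<inter> S"
    using inner_entry_iff_mem v_perm(1) by (auto simp: plot_def)
  then show ?thesis by (auto simp: plot)
qed

lemma standardize_delete_outer:
  assumes "w \<in> permutations_of_set {1..k}" "strict_mono_on {1..k} c" "plot c c w = S"
  shows "standardize (delete_outer v) = w"
proof -
  obtain g' where "strict_mono_on {1..length (delete_outer v)} g'" "plot g' g (delete_outer v) = S"
    using plot_filter_exists[of v g "inner_entry v" g] mono_g image_inner_entries v_perm(1)
    by (auto simp: delete_outer_def)
  moreover have "strict_mono_on (set (delete_outer v)) g"
    using mono_g v_perm(2) by (auto simp: delete_outer_def intro: monotone_on_subset)
  ultimately show ?thesis using standardize_eq_if_plot_eq[OF assms(1,2,2)] assms(3) by metis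
qed

lemma largest_gap_framed: "largest_gap v = card {s \<in> S. fst s < t}"
proof -
  let ?pt = "\<lambda>i. (g (Suc i), g (v ! i))"
  have coord_less: "g (Suc i) < g (Suc j) \<longleftrightarrow> i < j" if "i < n" "j < n" for i j
    using strict_mono_on_less[OF mono_g] that by simp
  have "north \<in> plot g g v" unfolding plot by (simp add: frame_points_def)
  then obtain q where q: "q < n" "g (Suc q) = t" "g (v ! q) = m"
    using v_perm(1) by (auto simp: plot_def)
  have "g n = m" using frame_coords[OF mono_g] fst_plot[of g g v] by (simp add: plot v_perm(1))
  then have "v ! q = n"
    using strict_mono_on_eq[OF mono_g, of "v ! q" n] v_perm(4)[OF q(1)] q(1,3) by simp
  have "{s \<in> S. fst s < t} =
      ?pt ` {i \<in> {i. i < n \<and> inner_entry v (v ! i)}. g (Suc i) < g (Suc q)}"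
    unfolding image_inner_entries[symmetric] q(2) by auto
  also have "\<dots> = ?pt ` {i. i < q \<and> inner_entry v (v ! i)}"
    using q(1) coord_less by (intro arg_cong[where f = "image ?pt"]) auto
  finally have "card {s \<in> S. fst s < t} = card (?pt ` {i. i < q \<and> inner_entry v (v ! i)})" by simp
  also have "\<dots> = card {i. i < q \<and> inner_entry v (v ! i)}"
    using strict_mono_on_eq[OF mono_g] q(1) by (intro card_image inj_onI) auto
  finally show ?thesis using largest_gap_eq_card[OF perm q(1) \<open>v ! q = n\<close>] by simp
qed

end

end

subsection \<open>Centred coordinates\<close>

definition coord :: "nat \<Rightarrow> nat \<Rightarrow> int" where
  "coord n i = 2 * int i - int n - 1"

definition points :: "nat \<Rightarrow> nat list \<Rightarrow> (int \<times> int) set" where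
  "points n w = plot (coord n) (coord n) w"

lemma strict_mono_on_coord: "strict_mono_on A (coord n)"
  by (simp add: strict_mono_on_def coord_def)

lemma avoids_3142_points:
  assumes "baxter_perm n w"
  shows "avoids_3142 (points n w)" "avoids_3142 (hflip ` points n w)"
  using assms baxter_iff_avoids_3142[of w "coord n" "coord n"]
  by (simp_all add: strict_mono_on_coord baxter_perm_def points_def)

lemma avoids_3142_insert_points:
  assumes "length w = n" "p \<le> n" "baxter (insert_largest p w)"
  defines "north \<equiv> (2 * int p - int n, int n + 1)"
  shows "avoids_3142 (insert north (points n w))"
    "avoids_3142 (hflip ` insert north (points n w))"
proof -
  define g where "g i = (if i \<le> p then coord n i
    else if i = Suc p then 2 * int p - int n else coord n (i - 1))" for i
  have "(\<lambda>i. if i \<le> p then g i else g (Suc i)) = coord n" by (auto simp: g_def)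
  then have "plot g (coord n) (insert_largest p w) = insert north (points n w)"
    using plot_insert_largest[of p w g "coord n"] assms(1,2)
    by (simp add: g_def coord_def[of n "Suc n"] points_def north_def add.commute)
  moreover have "strict_mono_on A g" for A
    by (auto simp: strict_mono_on_def g_def coord_def)
  ultimately show "avoids_3142 (insert north (points n w))"
      "avoids_3142 (hflip ` insert north (points n w))"
    using baxter_iff_avoids_3142[of "insert_largest p w" g "coord n"] assms(3)
    by (simp_all add: strict_mono_on_coord)
qed

lemma card_points_left:
  assumes "length w = n" "p \<le> n"
  shows "card {s \<in> points n w. fst s < 2 * int p - int n} = p"
proof -
  have "{s \<in> points n w. fst s < 2 * int p - int n} =
      (\<lambda>i. (coord n (Suc i), coord n (w ! i))) ` {..<p}"
    using assms by (auto simp: points_def plot_def coord_def)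
  then show ?thesis by (simp add: card_image inj_on_def coord_def)
qed

lemma framing_points:
  assumes "n \<ge> 1" "baxter_perm n w" "rotation_fixed w" "p \<le> n"
  shows "framing (points n w) (int n + 1) (2 * int p - int n)"
proof -
  have perm: "w \<in> permutations_of_set {1..n}" using assms(2) by (simp add: baxter_perm_def)
  note length_w = permutations_of_upto_D(1)[OF perm]
  interpret rotation_invariant "points n w"
    unfolding points_def using perm _ _ assms(3)
  proof (rule rotation_invariant_plot)
    show "inj_on (coord n) {1..n}" by (rule strict_mono_on_imp_inj_on[OF strict_mono_on_coord])
    show "coord n (n - i) = - coord n (Suc i)" if "i < n" for i
      using that by (simp add: coord_def)
  qed
  have fst_points: "fst ` points n w = coord n ` {1..n}" by (simp add: points_def fst_plot length_w)
  show ?thesis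
  proof
    show "\<bar>fst s\<bar> < int n + 1" if "s \<in> points n w" for s
      using imageI[OF that, of fst] unfolding fst_points by (auto simp: coord_def)
    have "points n w \<noteq> {}"
      using assms(1) by (auto simp: points_def plot_def length_w lessThan_empty_iff)
    then show "(0, 0) \<in> points n w"
      using origin_mem_if_avoids_3142 avoids_3142_points[OF assms(2)] by blast
    show "\<bar>2 * int p - int n\<bar> < int n + 1" using assms(4) by simp
    show "2 * int p - int n \<notin> fst ` points n w"
      unfolding fst_points by (auto simp: coord_def) presburger
  qed
qed

theorem theorem5p5:
  fixes n p :: nat and w :: "nat list"
  assumes "n \<ge> 1"
    and "baxter_perm n w"
    and "rotation_fixed w"
    and "p \<le> n"
    and "baxter_perm (n + 1) (insert_largest p w)"
  shows "\<exists>w'. baxter_perm (n + 4) w' \<and> rotation_fixed w' \<and>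
           standardize (delete_outer w') = w \<and> largest_gap w' = p"
proof -
  have perm: "w \<in> permutations_of_set {1..n}" using assms(2) by (simp add: baxter_perm_def)
  note length_w = permutations_of_upto_D(1)[OF perm]
  interpret framing "points n w" "int n + 1" "2 * int p - int n"
    using assms(1-4) by (rule framing_points)
  interpret framed: rotation_invariant framed by (fact rotation_invariant_framed)
  have "card (points n w) = n"
    by (simp add: points_def card_plot length_w strict_mono_on_coord strict_mono_on_imp_inj_on)
  then obtain v g where v: "v \<in> permutations_of_set {1..n + 4}" "rotation_fixed v"
    and mono_g: "strict_mono_on {1..n + 4} g" and plot: "plot g g v = framed"
    using framed.rotation_fixed_perm_exists by (auto simp: card_framed)
  have "avoids_3142 framed" "avoids_3142 (hflip ` framed)"
    using avoids_3142_framed_and_hflip avoids_3142_points[OF assms(2)]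
      avoids_3142_insert_points[OF length_w assms(4)] assms(5) by (simp_all add: baxter_perm_def)
  then have "baxter_perm (n + 4) v"
    using baxter_iff_avoids_3142[of v g g] mono_g v(1)
    by (simp add: baxter_perm_def plot permutations_of_upto_D[OF v(1)])
  moreover have "standardize (delete_outer v) = w"
    using standardize_delete_outer[OF v(1) mono_g plot perm strict_mono_on_coord]
    by (simp add: points_def)
  moreover have "largest_gap v = p"
    using largest_gap_framed[OF v(1) mono_g plot] card_points_left[OF length_w assms(4)] by simp
  ultimately show ?thesis using v(2) by blast
qed

end
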